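(* We have \[ \mathrm{Ass}^{\mathrm{TKK}}(L(2)\otimes B)=k\oplus L(2)\otimes B\oplus\bigoplus_{p\ge 2}\mathrm{Mat}_2(B^{\otimes p}) \] where the product is given by simultaneously performing the matrix product and the concatenation of tensors.
   Context: We work over a field $k$ of characteristic zero. For $n\ge 0$, $L(n)$ denotes the irreducible $\mathfrak{sl}_2$-module of highest weight $n$; $L(2)\cong\mathfrak{sl}_2$ is the adjoint module, identified with traceless $2\times 2$ matrices via the standard embedding, so that $\mathrm{Mat}_2\cong L(0)\oplus L(2)$ as $\mathfrak{sl}_2$-modules ($\mathrm{Mat}_2$ denotes $2\times 2$ matrices). The category $\mathrm{TKK}$ has as objects the completely reducible $\mathfrak{sl}_2$-modules that are direct sums of copies of $L(0)$ and $L(2)$, and as morphisms $\mathfrak{sl}_2$-module maps. For a vector space $B$, $\mathrm{Ass}^{\mathrm{TKK}}(L(2)\otimes B)$ is the free unital associative algebra in $\mathrm{TKK}$ generated by $L(2)\otimes B$, i.e. the quotient of the tensor algebra $T(L(2)\otimes B)$ by the ideal generated by all $\mathfrak{sl}_2$-isotypic components $L(m)$ with $m\ne 0,2$. *)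

theory Defs
  imports "HOL-Analysis.Analysis"
begin

text \<open>Basis of sl2 = L(2): e, h, f (traceless 2x2 matrices).\<close>
datatype sl2b = E | H | F

definition mat_of :: "sl2b \<Rightarrow> 'k::comm_ring_1^2^2" where
  "mat_of X = (case X of
      E \<Rightarrow> (\<chi> i j. if i = 0 \<and> j = 1 then 1 else 0)
    | H \<Rightarrow> (\<chi> i j. if i = j then (if i = 0 then 1 else -1) else 0)
    | F \<Rightarrow> (\<chi> i j. if i = 1 \<and> j = 0 then 1 else 0))"

text \<open>coef X a a' = coefficient of a' in [X, a] (adjoint action).\<close>
fun coef :: "sl2b \<Rightarrow> sl2b \<Rightarrow> sl2b \<Rightarrow> 'k::comm_ring_1" where
  "coef E H E = -2"
| "coef E F H = 1"
| "coef H E E = 2"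
| "coef H F F = -2"
| "coef F E H = -1"
| "coef F H F = 2"
| "coef _ _ _ = 0"

text \<open>B is the free k-vector space on the basis type 'b. The tensor algebra
T(L(2) \<otimes> B) is modelled as finitely supported functions on words over the
basis {e,h,f} \<times> 'b of L(2) \<otimes> B; the product is concatenation (convolution).\<close>

definition finsupp :: "('a list \<Rightarrow> 'k::zero) \<Rightarrow> bool" where
  "finsupp f \<longleftrightarrow> finite {w. f w \<noteq> 0}"

definition tmul :: "('a list \<Rightarrow> 'k::comm_ring_1) \<Rightarrow> ('a list \<Rightarrow> 'k) \<Rightarrow> 'a list \<Rightarrow> 'k" where
  "tmul f g w = (\<Sum>i\<le>length w. f (take i w) * g (drop i w))"

definition tone :: "'a list \<Rightarrow> 'k::comm_ring_1" where
  "tone w = (if w = [] then 1 else 0)"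

text \<open>The sl2-action on T(L(2) \<otimes> B): adjoint on L(2), trivial on B, extended
as a derivation.\<close>
definition act :: "sl2b \<Rightarrow> ((sl2b \<times> 'b) list \<Rightarrow> 'k::comm_ring_1) \<Rightarrow> (sl2b \<times> 'b) list \<Rightarrow> 'k" where
  "act X \<phi> w = (\<Sum>i<length w. \<Sum>a\<in>{E, H, F}.
      coef X a (fst (w ! i)) * \<phi> (w[i := (a, snd (w ! i))]))"

text \<open>Highest weight vectors of weight m.\<close>
definition hwv :: "nat \<Rightarrow> ((sl2b \<times> 'b) list \<Rightarrow> 'k::comm_ring_1) \<Rightarrow> bool" where
  "hwv m \<phi> \<longleftrightarrow> finsupp \<phi> \<and> act E \<phi> = (\<lambda>_. 0) \<and> act H \<phi> = (\<lambda>w. of_nat m * \<phi> w)"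

text \<open>Union of the isotypic components L(m), m \<noteq> 0,2: spanned by f^i v for
highest weight vectors v of weight m.\<close>
definition bad_components :: "((sl2b \<times> 'b) list \<Rightarrow> 'k::comm_ring_1) set" where
  "bad_components = {(act F ^^ i) \<phi> | i \<phi> m. m \<noteq> 0 \<and> m \<noteq> 2 \<and> hwv m \<phi>}"

text \<open>Two-sided ideal generated by a set G.\<close>
inductive_set ideal_gen :: "('a list \<Rightarrow> 'k::comm_ring_1) set \<Rightarrow> ('a list \<Rightarrow> 'k) set"
  for G where
  zero: "(\<lambda>_. 0) \<in> ideal_gen G"
| gen: "finsupp a \<Longrightarrow> finsupp b \<Longrightarrow> g \<in> G \<Longrightarrow> tmul (tmul a g) b \<in> ideal_gen G"
| add: "x \<in> ideal_gen G \<Longrightarrow> y \<in> ideal_gen G \<Longrightarrow> (\<lambda>w. x w + y w) \<in> ideal_gen G"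

text \<open>Mat_2(T(B)) = \<Oplus>_p Mat_2(B^{\<otimes>p}): finitely supported functions from
words over 'b to 2x2 matrices; product = matrix product + concatenation.\<close>
definition mmul :: "('b list \<Rightarrow> 'k::comm_ring_1^2^2) \<Rightarrow> ('b list \<Rightarrow> 'k^2^2) \<Rightarrow> 'b list \<Rightarrow> 'k^2^2" where
  "mmul M N \<beta> = (\<Sum>i\<le>length \<beta>. M (take i \<beta>) ** N (drop i \<beta>))"

definition mone :: "'b list \<Rightarrow> 'k::comm_ring_1^2^2" where
  "mone \<beta> = (if \<beta> = [] then mat 1 else 0)"

text \<open>sl2 acts on Mat_2 by conjugation (commutator).\<close>
definition bracket :: "sl2b \<Rightarrow> 'k::comm_ring_1^2^2 \<Rightarrow> 'k^2^2" where
  "bracket X M = mat_of X ** M - M ** mat_of X"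

text \<open>The subalgebra k \<oplus> L(2)\<otimes>B \<oplus> \<Oplus>_{p\<ge>2} Mat_2(B^{\<otimes>p}).\<close>
definition TKK_alg :: "('b list \<Rightarrow> 'k::comm_ring_1^2^2) set" where
  "TKK_alg = {M. finite {\<beta>. M \<beta> \<noteq> 0} \<and> (\<exists>c. M [] = mat c)
      \<and> (\<forall>\<beta>. length \<beta> = 1 \<longrightarrow> M \<beta> $ 0 $ 0 + M \<beta> $ 1 $ 1 = 0)}"

text \<open>The natural algebra map T(L(2)\<otimes>B) \<rightarrow> Mat_2(T(B)),
(x_1\<otimes>b_1)...(x_n\<otimes>b_n) \<mapsto> (x_1 \<cdots> x_n) \<otimes> (b_1\<otimes>...\<otimes>b_n).\<close>
definition Phi :: "((sl2b \<times> 'b) list \<Rightarrow> 'k::comm_ring_1) \<Rightarrow> 'b list \<Rightarrow> 'k^2^2" where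
  "Phi \<phi> \<beta> = (\<Sum>as\<in>{as. length as = length \<beta>}.
      (\<chi> i j. \<phi> (zip as \<beta>) * (foldr (**) (map mat_of as) (mat 1)) $ i $ j))"

end

theory Submission
  imports Defs
begin

text \<open>
  \<open>Phi\<close> sends a word \<open>(x\<^sub>1 \<otimes> b\<^sub>1) \<cdots> (x\<^sub>n \<otimes> b\<^sub>n)\<close> to the matrix
  product \<open>x\<^sub>1 \<cdots> x\<^sub>n\<close> tensored with \<open>b\<^sub>1 \<otimes> \<cdots> \<otimes> b\<^sub>n\<close>. It is
  multiplicative because matrix products and concatenation are, and equivariant because
  \<open>ad X\<close> acts on matrix products as a derivation. Since \<open>ad h\<close> has only the eigenvalues
  \<open>0, \<plusminus>2\<close> on \<open>Mat\<^sub>2\<close>, highest weight vectors of weight \<open>m \<noteq> 0, 2\<close> are killed,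
  so the ideal lies in the kernel.

  Conversely, the \<open>f\<close>-descendants of the weight-4 vector \<open>(e \<otimes> b)(e \<otimes> b')\<close> give the
  quadratic relations \<open>ee, eh + he, hh - ef - fe, fh + hf, ff\<close>. Modulo these, every word
  reduces to a combination of normal words: words of length at most one and words
  \<open>p h\<^sup>k\<close> with \<open>p \<in> {ef, fe, he, hf}\<close>; prepending a letter to a normal word only requires
  rewriting its first three letters. \<open>Phi\<close> sends the four normal words over a given
  \<open>b\<^sub>1 \<otimes> \<cdots> \<otimes> b\<^sub>n\<close>, \<open>n \<ge> 2\<close>, to the four matrix units up to sign, hence is
  injective on normal combinations; the same computation gives the image.
\<close>

section \<open>The convolution algebra of words\<close>

definition word_monom :: "'a list \<Rightarrow> 'a list \<Rightarrow> 'k::comm_ring_1" where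
  "word_monom u w = (if w = u then 1 else 0)"

lemma bij_betw_splits:
  "bij_betw (\<lambda>i. (take i w, drop i w)) {..length w} {p. fst p @ snd p = w}"
proof (rule bij_betwI[where g="\<lambda>p. length (fst p)"])
  fix p assume "p \<in> {p. fst p @ snd p = w}"
  then show "(take (length (fst p)) w, drop (length (fst p)) w) = p" by (cases p) auto
qed auto

lemma finite_splits: "finite {p. fst p @ snd p = (w :: 'a list)}"
  using bij_betw_finite[OF bij_betw_splits[of w]] by simp

lemma tmul_eq_sum_splits: "tmul f g w = (\<Sum>p\<in>{p. fst p @ snd p = w}. f (fst p) * g (snd p))"
  unfolding tmul_def by (simp add: sum.reindex_bij_betw[OF bij_betw_splits, symmetric])

lemma tmul_tmul_eq_sum_triples:
  fixes w :: "'a list"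
  defines "T \<equiv> {t. fst t @ fst (snd t) @ snd (snd t) = w}"
  shows "tmul (tmul f g) h w = (\<Sum>t\<in>T. f (fst t) * g (fst (snd t)) * h (snd (snd t)))"
    and "tmul f (tmul g h) w = (\<Sum>t\<in>T. f (fst t) * g (fst (snd t)) * h (snd (snd t)))"
proof -
  have "tmul (tmul f g) h w = (\<Sum>p\<in>{p. fst p @ snd p = w}.
      \<Sum>q\<in>{q. fst q @ snd q = fst p}. f (fst q) * g (snd q) * h (snd p))"
    by (simp add: tmul_eq_sum_splits sum_distrib_right)
  also have "\<dots> = (\<Sum>(p, q)\<in>(SIGMA p:{p. fst p @ snd p = w}. {q. fst q @ snd q = fst p}).
      f (fst q) * g (snd q) * h (snd p))"
    by (rule sum.Sigma) (auto simp: finite_splits)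
  also have "\<dots> = (\<Sum>t\<in>T. f (fst t) * g (fst (snd t)) * h (snd (snd t)))"
    unfolding T_def
    by (rule sum.reindex_bij_witness[where i="\<lambda>t. ((fst t @ fst (snd t), snd (snd t)), (fst t, fst (snd t)))"
          and j="\<lambda>pq. (fst (snd pq), snd (snd pq), snd (fst pq))"]) auto
  finally show "tmul (tmul f g) h w = (\<Sum>t\<in>T. f (fst t) * g (fst (snd t)) * h (snd (snd t)))" .
  have "tmul f (tmul g h) w = (\<Sum>p\<in>{p. fst p @ snd p = w}.
      \<Sum>q\<in>{q. fst q @ snd q = snd p}. f (fst p) * g (fst q) * h (snd q))"
    by (simp add: tmul_eq_sum_splits sum_distrib_left mult.assoc)
  also have "\<dots> = (\<Sum>(p, q)\<in>(SIGMA p:{p. fst p @ snd p = w}. {q. fst q @ snd q = snd p}).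
      f (fst p) * g (fst q) * h (snd q))"
    by (rule sum.Sigma) (auto simp: finite_splits)
  also have "\<dots> = (\<Sum>t\<in>T. f (fst t) * g (fst (snd t)) * h (snd (snd t)))"
    unfolding T_def
    by (rule sum.reindex_bij_witness[where i="\<lambda>t. ((fst t, fst (snd t) @ snd (snd t)), (fst (snd t), snd (snd t)))"
          and j="\<lambda>pq. (fst (fst pq), fst (snd pq), snd (snd pq))"]) auto
  finally show "tmul f (tmul g h) w = (\<Sum>t\<in>T. f (fst t) * g (fst (snd t)) * h (snd (snd t)))" .
qed

lemma tmul_assoc: "tmul (tmul f g) h = tmul f (tmul g h)"
  by (rule ext) (simp only: tmul_tmul_eq_sum_triples)

lemma tmul_add_left: "tmul (\<lambda>w. f w + g w) h = (\<lambda>w. tmul f h w + tmul g h w)"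
  by (rule ext) (simp add: tmul_def distrib_right sum.distrib)

lemma tmul_add_right: "tmul h (\<lambda>w. f w + g w) = (\<lambda>w. tmul h f w + tmul h g w)"
  by (rule ext) (simp add: tmul_def distrib_left sum.distrib)

lemma tmul_diff_left: "tmul (\<lambda>w. f w - g w) h = (\<lambda>w. tmul f h w - tmul g h w)"
  by (rule ext) (simp add: tmul_def left_diff_distrib sum_subtractf)

lemma tmul_diff_right: "tmul h (\<lambda>w. f w - g w) = (\<lambda>w. tmul h f w - tmul h g w)"
  by (rule ext) (simp add: tmul_def right_diff_distrib sum_subtractf)

lemma tmul_scale_left: "tmul (\<lambda>w. c * f w) h = (\<lambda>w. c * tmul f h w)"
  by (rule ext) (simp add: tmul_def sum_distrib_left mult.assoc)

lemma tmul_scale_right: "tmul h (\<lambda>w. c * f w) = (\<lambda>w. c * tmul h f w)"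
  by (rule ext) (simp add: tmul_def sum_distrib_left mult.left_commute)

lemma tmul_zero_left: "tmul (\<lambda>_. 0) h = (\<lambda>_. 0)"
  by (rule ext) (simp add: tmul_def)

lemma tmul_zero_right: "tmul h (\<lambda>_. 0) = (\<lambda>_. 0)"
  by (rule ext) (simp add: tmul_def)

lemma tmul_word_monom_left:
  "tmul (word_monom u) f w = (if take (length u) w = u then f (drop (length u) w) else 0)"
proof -
  have "tmul (word_monom u) f w = (\<Sum>i\<le>length w.
      if i = length u \<and> take (length u) w = u then f (drop (length u) w) else 0)"
    unfolding tmul_def word_monom_def by (rule sum.cong) (auto intro: sum.cong)
  moreover have "length u \<le> length w" if "take (length u) w = u"
    using that by (metis append_take_drop_id le_add1 length_append)
  ultimately show ?thesis by (simp add: sum.delta')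
qed

lemma tmul_word_monom_right:
  "tmul f (word_monom v) w
    = (if drop (length w - length v) w = v then f (take (length w - length v) w) else 0)"
proof -
  have "tmul f (word_monom v) w = (\<Sum>i\<le>length w. if i = length w - length v
      \<and> drop (length w - length v) w = v then f (take (length w - length v) w) else 0)"
    unfolding tmul_def word_monom_def by (rule sum.cong) auto
  then show ?thesis by (simp add: sum.delta')
qed

lemma tmul_word_monom: "tmul (word_monom u) (word_monom v) = word_monom (u @ v)"
  by (rule ext) (auto simp: tmul_word_monom_left word_monom_def, metis append_take_drop_id)

lemma tone_eq_word_monom: "tone = word_monom []"
  by (rule ext) (simp add: tone_def word_monom_def)

lemma tmul_tone_left: "tmul tone f = f"
  by (rule ext) (simp add: tone_eq_word_monom tmul_word_monom_left)

lemma tmul_tone_right: "tmul f tone = f"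
  by (rule ext) (simp add: tone_eq_word_monom tmul_word_monom_right)

lemma finsupp_zero [simp]: "finsupp (\<lambda>_. 0)"
  by (simp add: finsupp_def)

lemma finsupp_word_monom [simp]: "finsupp (word_monom u)"
  unfolding finsupp_def word_monom_def by (rule finite_subset[of _ "{u}"]) auto

lemma finsupp_add: "finsupp (f :: _ \<Rightarrow> 'k::monoid_add) \<Longrightarrow> finsupp g \<Longrightarrow> finsupp (\<lambda>w. f w + g w)"
  unfolding finsupp_def by (rule finite_subset[of _ "{w. f w \<noteq> 0} \<union> {w. g w \<noteq> 0}"]) auto

lemma finsupp_scale: "finsupp (f :: _ \<Rightarrow> 'k::mult_zero) \<Longrightarrow> finsupp (\<lambda>w. c * f w)"
  unfolding finsupp_def by (rule finite_subset[of _ "{w. f w \<noteq> 0}"]) auto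

lemma finsupp_tmul:
  assumes "finsupp f" "finsupp g"
  shows "finsupp (tmul f g)"
proof -
  have "{w. tmul f g w \<noteq> 0} \<subseteq> (\<lambda>p. fst p @ snd p) ` ({w. f w \<noteq> 0} \<times> {w. g w \<noteq> 0})"
  proof
    fix w assume "w \<in> {w. tmul f g w \<noteq> 0}"
    then have "(\<Sum>i\<le>length w. f (take i w) * g (drop i w)) \<noteq> 0"
      unfolding tmul_def by simp
    then obtain i where "f (take i w) * g (drop i w) \<noteq> 0"
      using sum.not_neutral_contains_not_neutral by blast
    then show "w \<in> (\<lambda>p. fst p @ snd p) ` ({w. f w \<noteq> 0} \<times> {w. g w \<noteq> 0})"
      by (intro image_eqI[of _ _ "(take i w, drop i w)"]) auto
  qed
  moreover have "finite ((\<lambda>p. fst p @ snd p) ` ({w. f w \<noteq> 0} \<times> {w. g w \<noteq> 0}))"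
    using assms unfolding finsupp_def by (intro finite_imageI finite_cartesian_product)
  ultimately show ?thesis unfolding finsupp_def by (rule finite_subset)
qed

lemma finsupp_eq_sum_word_monom:
  assumes "finsupp f"
  shows "f = (\<lambda>w. \<Sum>u\<in>{u. f u \<noteq> 0}. f u * word_monom u w)"
proof
  fix w
  have "(\<Sum>u\<in>{u. f u \<noteq> 0}. f u * word_monom u w) = (\<Sum>u\<in>{u. f u \<noteq> 0}. if w = u then f u else 0)"
    by (rule sum.cong) (auto simp: word_monom_def)
  also have "\<dots> = f w"
    using assms unfolding finsupp_def by (simp add: sum.delta')
  finally show "f w = (\<Sum>u\<in>{u. f u \<noteq> 0}. f u * word_monom u w)" by simp
qed

lemma finsupp_induct [consumes 1, case_names zero add monom]:
  assumes "finsupp f"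
    and zero: "P (\<lambda>_. 0)"
    and add: "\<And>g h. P g \<Longrightarrow> P h \<Longrightarrow> P (\<lambda>w. g w + h w)"
    and monom: "\<And>c u. f u \<noteq> 0 \<Longrightarrow> P (\<lambda>w. c * word_monom u w)"
  shows "P f"
proof -
  have sums: "P (\<lambda>w. \<Sum>u\<in>S. f u * word_monom u w)" if "finite S" "S \<subseteq> {u. f u \<noteq> 0}" for S
    using that
  proof (induction S rule: finite_induct)
    case (insert u S)
    then have "P (\<lambda>w. f u * word_monom u w + (\<Sum>v\<in>S. f v * word_monom v w))"
      by (intro add monom) auto
    then show ?case using insert.hyps by simp
  qed (simp add: zero)
  have "P (\<lambda>w. \<Sum>u\<in>{u. f u \<noteq> 0}. f u * word_monom u w)"
    using assms(1) unfolding finsupp_def by (intro sums) auto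
  then show ?thesis by (simp only: finsupp_eq_sum_word_monom[OF assms(1), symmetric])
qed

lemma ideal_gen_scale: "x \<in> ideal_gen G \<Longrightarrow> (\<lambda>w. c * x w) \<in> ideal_gen G"
proof (induction rule: ideal_gen.induct)
  case (gen a b g)
  then show ?case
    using ideal_gen.gen[OF finsupp_scale[OF gen(1)] gen(2,3)] by (simp add: tmul_scale_left)
next
  case (add x y)
  then show ?case using ideal_gen.add[OF add.IH] by (simp add: distrib_left)
qed (simp add: ideal_gen.zero)

lemma ideal_gen_diff: "x \<in> ideal_gen G \<Longrightarrow> y \<in> ideal_gen G \<Longrightarrow> (\<lambda>w. x w - y w) \<in> ideal_gen G"
  using ideal_gen.add[OF _ ideal_gen_scale, of x G y "-1"] by simp

lemma ideal_gen_tmul_left: "y \<in> ideal_gen G \<Longrightarrow> finsupp x \<Longrightarrow> tmul x y \<in> ideal_gen G"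
proof (induction rule: ideal_gen.induct)
  case (gen a b g)
  then show ?case
    using ideal_gen.gen[OF finsupp_tmul[OF gen(4,1)] gen(2,3)] by (simp add: tmul_assoc)
qed (simp_all add: tmul_zero_right tmul_add_right ideal_gen.zero ideal_gen.add)

lemma ideal_gen_tmul_right: "y \<in> ideal_gen G \<Longrightarrow> finsupp x \<Longrightarrow> tmul y x \<in> ideal_gen G"
proof (induction rule: ideal_gen.induct)
  case (gen a b g)
  then show ?case
    using ideal_gen.gen[OF gen(1) finsupp_tmul[OF gen(2,4)] gen(3)] by (simp add: tmul_assoc)
qed (simp_all add: tmul_zero_left tmul_add_left ideal_gen.zero ideal_gen.add)

lemma ideal_gen_generator: "g \<in> G \<Longrightarrow> g \<in> ideal_gen G"
  using ideal_gen.gen[OF finsupp_word_monom finsupp_word_monom, of g G "[]" "[]"]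
  by (simp add: tone_eq_word_monom[symmetric] tmul_tone_left tmul_tone_right)

section \<open>The matrix realisation \<open>Phi\<close>\<close>

lemma UNIV_sl2b: "(UNIV :: sl2b set) = {E, H, F}"
  by (auto intro: sl2b.exhaust)

instance sl2b :: finite
  by standard (simp add: UNIV_sl2b)

lemma sum_sl2b: "(\<Sum>a\<in>UNIV. f a) = f E + f H + f F"
  by (simp add: UNIV_sl2b add.assoc)

lemma all_sl2b: "(\<forall>x. P x) \<longleftrightarrow> P E \<and> P H \<and> P F"
  by (metis sl2b.exhaust)

lemma UNIV_2: "(UNIV :: 2 set) = {0, 1}"
proof -
  have "x = 0 \<or> x = 1" for x :: 2
    using exhaust_2[of x] by auto
  then show ?thesis by auto
qed

lemma all_2: "(\<forall>i::2. P i) \<longleftrightarrow> P 0 \<and> P 1"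
  by (metis UNIV_2 UNIV_I empty_iff insert_iff)

lemma sum_2: "(\<Sum>k\<in>UNIV. f k) = f (0 :: 2) + f 1"
  by (simp add: UNIV_2)

lemma mat2_eq_iff:
  "(A :: 'a^2^2) = B \<longleftrightarrow> A$0$0 = B$0$0 \<and> A$0$1 = B$0$1 \<and> A$1$0 = B$1$0 \<and> A$1$1 = B$1$1"
  by (auto simp: vec_eq_iff all_2)

lemma matrix_mult_2_nth: "((A :: 'a::semiring_1^2^2) ** B) $ i $ j = A$i$0 * B$0$j + A$i$1 * B$1$j"
  by (simp add: matrix_matrix_mult_def sum_2)

lemma mat_2_nth [simp]:
  "(mat c :: 'a::zero^2^2) $ 0 $ 0 = c" "(mat c :: 'a^2^2) $ 0 $ 1 = 0"
  "(mat c :: 'a^2^2) $ 1 $ 0 = 0" "(mat c :: 'a^2^2) $ 1 $ 1 = c"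
  by (simp_all add: mat_def)

lemma mat_of_nth [simp]:
  "mat_of E $ 0 $ 0 = 0" "mat_of E $ 0 $ 1 = 1" "mat_of E $ 1 $ 0 = 0" "mat_of E $ 1 $ 1 = 0"
  "mat_of H $ 0 $ 0 = 1" "mat_of H $ 0 $ 1 = 0" "mat_of H $ 1 $ 0 = 0" "mat_of H $ 1 $ 1 = -1"
  "mat_of F $ 0 $ 0 = 0" "mat_of F $ 0 $ 1 = 0" "mat_of F $ 1 $ 0 = 1" "mat_of F $ 1 $ 1 = 0"
  by (simp_all add: mat_of_def)

definition mat_scale :: "'k::times \<Rightarrow> 'k^'n^'m \<Rightarrow> 'k^'n^'m" where
  "mat_scale c M = (\<chi> i j. c * M $ i $ j)"

lemma mat_scale_nth [simp]: "mat_scale c M $ i $ j = c * M $ i $ j"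
  by (simp add: mat_scale_def)

lemma mat_scale_0 [simp]: "mat_scale 0 M = (0 :: 'k::mult_zero^'n^'m)"
  by (simp add: vec_eq_iff)

lemma mat_scale_1 [simp]: "mat_scale 1 M = (M :: 'k::monoid_mult^'n^'m)"
  by (simp add: vec_eq_iff)

lemma mat_scale_mat_scale: "mat_scale c (mat_scale d M) = mat_scale (c * d) (M :: 'k::semigroup_mult^'n^'m)"
  by (simp add: vec_eq_iff mult.assoc)

lemma mat_scale_matrix_mult_left:
  "mat_scale c A ** B = mat_scale c (A ** (B :: 'k::comm_semiring_1^_^_))"
  by (simp add: vec_eq_iff matrix_matrix_mult_def sum_distrib_left mult.assoc)

lemma mat_scale_matrix_mult_right:
  "A ** mat_scale c B = mat_scale c (A ** (B :: 'k::comm_semiring_1^_^_))"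
  by (simp add: vec_eq_iff matrix_matrix_mult_def sum_distrib_left mult.left_commute)

lemma mat_scale_sum_left: "mat_scale (\<Sum>x\<in>S. f x) M = (\<Sum>x\<in>S. mat_scale (f x) (M :: 'k::comm_semiring_1^'n^'m))"
  by (simp add: vec_eq_iff sum_distrib_right)

lemma mat_scale_sum_right: "mat_scale c (\<Sum>x\<in>S. f x) = (\<Sum>x\<in>S. mat_scale c (f x :: 'k::comm_semiring_1^'n^'m))"
  by (simp add: vec_eq_iff sum_distrib_left)

lemma matrix_mult_sum_left: "(\<Sum>x\<in>S. f x) ** (B :: 'k::comm_semiring_1^_^_) = (\<Sum>x\<in>S. f x ** B)"
  by (simp add: vec_eq_iff matrix_matrix_mult_def sum_distrib_right) (intro allI sum.swap)

lemma matrix_mult_sum_right: "(B :: 'k::comm_semiring_1^_^_) ** (\<Sum>x\<in>S. f x) = (\<Sum>x\<in>S. B ** f x)"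
  by (simp add: vec_eq_iff matrix_matrix_mult_def sum_distrib_left) (intro allI sum.swap)

lemma matrix_mult_diff_left: "(A - B) ** (C :: 'k::ring_1^_^_) = A ** C - B ** C"
  by (simp add: vec_eq_iff matrix_matrix_mult_def sum_subtractf left_diff_distrib)

lemma matrix_mult_diff_right: "(C :: 'k::ring_1^_^_) ** (A - B) = C ** A - C ** B"
  by (simp add: vec_eq_iff matrix_matrix_mult_def sum_subtractf right_diff_distrib)

definition word_mat :: "sl2b list \<Rightarrow> 'k::comm_ring_1^2^2" where
  "word_mat as = foldr (**) (map mat_of as) (mat 1)"

lemma word_mat_Nil [simp]: "word_mat [] = mat 1"
  by (simp add: word_mat_def)

lemma word_mat_Cons [simp]: "word_mat (a # as) = mat_of a ** word_mat as"
  by (simp add: word_mat_def)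

lemma word_mat_append: "word_mat (as @ bs) = word_mat as ** word_mat bs"
  by (induction as) (simp_all add: matrix_mul_assoc)

lemma finite_lists_length_sl2b [simp]: "finite {as :: sl2b list. length as = n}"
  using finite_lists_length_eq[of "UNIV :: sl2b set" n] by simp

lemma Phi_eq_sum: "Phi \<phi> \<beta> = (\<Sum>as | length as = length \<beta>. mat_scale (\<phi> (zip as \<beta>)) (word_mat as))"
  by (simp add: Phi_def mat_scale_def word_mat_def)

lemma Phi_add: "Phi (\<lambda>w. \<phi> w + \<psi> w) \<beta> = Phi \<phi> \<beta> + Phi \<psi> \<beta>"
  by (simp add: Phi_eq_sum sum.distrib[symmetric] vec_eq_iff distrib_right)

lemma Phi_diff: "Phi (\<lambda>w. \<phi> w - \<psi> w) \<beta> = Phi \<phi> \<beta> - Phi \<psi> \<beta>"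
  by (simp add: Phi_eq_sum sum_subtractf[symmetric] vec_eq_iff left_diff_distrib)

lemma Phi_scale: "Phi (\<lambda>w. c * \<phi> w) \<beta> = mat_scale c (Phi \<phi> \<beta>)"
  by (simp add: Phi_eq_sum mat_scale_sum_right mat_scale_mat_scale)

lemma Phi_zero: "Phi (\<lambda>_. 0) \<beta> = 0"
  by (simp add: Phi_eq_sum)

lemma sum_lists_length_split:
  assumes "i \<le> n"
  shows "(\<Sum>as | length as = n. h (take i as) (drop i as))
    = (\<Sum>as | length as = i. \<Sum>bs | length bs = n - i. h as (bs :: sl2b list))"
proof -
  have "(\<Sum>as | length as = n. h (take i as) (drop i as))
      = (\<Sum>p\<in>{as. length as = i} \<times> {bs. length bs = n - i}. h (fst p) (snd p))"
    using assms
    by (intro sum.reindex_bij_witness[where i="\<lambda>p. fst p @ snd p" and j="\<lambda>as. (take i as, drop i as)"])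
      (auto simp: min_def)
  then show ?thesis by (simp add: sum.cartesian_product split_def)
qed

lemma Phi_tmul:
  fixes \<phi> \<psi> :: "(sl2b \<times> 'b) list \<Rightarrow> 'k::comm_ring_1"
  shows "Phi (tmul \<phi> \<psi>) = mmul (Phi \<phi>) (Phi \<psi>)"
proof
  fix \<beta> :: "'b list"
  define n where "n = length \<beta>"
  define g where "g i as bs = mat_scale (\<phi> (zip as (take i \<beta>)) * \<psi> (zip bs (drop i \<beta>)))
    (word_mat as ** word_mat bs)" for i as bs
  have "Phi (tmul \<phi> \<psi>) \<beta> = (\<Sum>as | length as = n. \<Sum>i\<le>n. g i (take i as) (drop i as))"
    unfolding Phi_eq_sum n_def g_def
    by (rule sum.cong) (auto simp: tmul_def mat_scale_sum_left take_zip drop_zip word_mat_append[symmetric])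
  also have "\<dots> = (\<Sum>i\<le>n. \<Sum>as | length as = n. g i (take i as) (drop i as))"
    by (rule sum.swap)
  also have "\<dots> = (\<Sum>i\<le>n. \<Sum>as | length as = i. \<Sum>bs | length bs = n - i. g i as bs)"
    by (rule sum.cong) (auto simp: sum_lists_length_split)
  also have "\<dots> = mmul (Phi \<phi>) (Phi \<psi>) \<beta>"
    unfolding mmul_def n_def[symmetric]
  proof (rule sum.cong)
    fix i assume "i \<in> {..n}"
    then have len: "length (take i \<beta>) = i" "length (drop i \<beta>) = n - i" by (auto simp: n_def)
    have "Phi \<phi> (take i \<beta>) ** Phi \<psi> (drop i \<beta>) =
      (\<Sum>as | length as = i. \<Sum>bs | length bs = n - i.
          mat_scale (\<phi> (zip as (take i \<beta>))) (word_mat as) ** mat_scale (\<psi> (zip bs (drop i \<beta>))) (word_mat bs))"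
      by (simp only: Phi_eq_sum len matrix_mult_sum_left matrix_mult_sum_right) (rule sum.swap)
    also have "\<dots> = (\<Sum>as | length as = i. \<Sum>bs | length bs = n - i. g i as bs)"
      unfolding g_def
      by (simp only: mat_scale_matrix_mult_left mat_scale_matrix_mult_right mat_scale_mat_scale mult.commute)
    finally show "(\<Sum>as | length as = i. \<Sum>bs | length bs = n - i. g i as bs) =
        Phi \<phi> (take i \<beta>) ** Phi \<psi> (drop i \<beta>)" by simp
  qed simp
  finally show "Phi (tmul \<phi> \<psi>) \<beta> = mmul (Phi \<phi>) (Phi \<psi>) \<beta>" .
qed

lemma Phi_tone: "Phi tone = mone"
proof
  fix \<beta>
  show "Phi tone \<beta> = mone \<beta>"
  proof (cases "\<beta> = []")
    case True
    have "{as :: sl2b list. length as = 0} = {[]}" by auto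
    then show ?thesis using True by (simp add: Phi_eq_sum mone_def tone_def)
  next
    case False
    then have "Phi tone \<beta> = (\<Sum>as | length as = length \<beta>. mat_scale 0 (word_mat as))"
      unfolding Phi_eq_sum by (intro sum.cong) (auto simp: tone_def)
    then show ?thesis using False by (simp add: mone_def)
  qed
qed

lemma mmul_zero_left: "mmul (\<lambda>_. 0) M = (\<lambda>_. 0)"
  by (rule ext) (simp add: mmul_def)

lemma mmul_zero_right: "mmul M (\<lambda>_. 0) = (\<lambda>_. 0)"
  by (rule ext) (simp add: mmul_def)

lemma bracket_nth: "bracket X M $ i $ j = (mat_of X ** M) $ i $ j - (M ** mat_of X) $ i $ j"
  by (simp add: bracket_def)

lemma bracket_mat_scale: "bracket X (mat_scale c M) = mat_scale c (bracket X M)"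
  by (simp add: bracket_def mat_scale_matrix_mult_left mat_scale_matrix_mult_right vec_eq_iff
      right_diff_distrib)

lemma bracket_sum: "bracket X (\<Sum>x\<in>S. f x) = (\<Sum>x\<in>S. bracket X (f x))"
  by (simp add: bracket_def matrix_mult_sum_left matrix_mult_sum_right sum_subtractf)

lemma sum_coef_mat_of:
  "(\<Sum>a'\<in>UNIV. mat_scale (coef X a a') (mat_of a')) = (bracket X (mat_of a) :: 'k::comm_ring_1^2^2)"
  by (cases X; cases a) (simp_all add: mat2_eq_iff sum_sl2b bracket_nth matrix_mult_2_nth)

lemma bracket_word_mat:
  "(\<Sum>i<length as. \<Sum>a\<in>UNIV. mat_scale (coef X (as ! i) a) (word_mat (as[i := a])))
    = (bracket X (word_mat as) :: 'k::comm_ring_1^2^2)"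
proof (induction as)
  case (Cons x as)
  let ?D = "\<lambda>as. \<Sum>i<length as. \<Sum>a\<in>UNIV. mat_scale (coef X (as ! i) a) (word_mat (as[i := a]))
    :: 'k^2^2"
  have "?D (x # as) = (\<Sum>a\<in>UNIV. mat_scale (coef X x a) (word_mat (a # as)))
      + (\<Sum>i<length as. \<Sum>a\<in>UNIV. mat_scale (coef X (as ! i) a) (word_mat (x # as[i := a])))"
    unfolding length_Cons sum.lessThan_Suc_shift by (simp del: word_mat_Cons)
  also have "(\<Sum>a\<in>UNIV. mat_scale (coef X x a) (word_mat (a # as))) = bracket X (mat_of x) ** word_mat as"
    by (simp add: mat_scale_matrix_mult_left[symmetric] matrix_mult_sum_left[symmetric] sum_coef_mat_of)
  also have "(\<Sum>i<length as. \<Sum>a\<in>UNIV. mat_scale (coef X (as ! i) a) (word_mat (x # as[i := a])))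
      = mat_of x ** ?D as"
    by (simp add: mat_scale_matrix_mult_right[symmetric] matrix_mult_sum_right)
  finally show ?case
    by (simp add: Cons.IH bracket_def matrix_mult_diff_left matrix_mult_diff_right matrix_mul_assoc)
qed (simp add: bracket_def)

lemma Phi_act: "Phi (act X \<phi>) \<beta> = bracket X (Phi \<phi> \<beta>)"
proof -
  define n where "n = length \<beta>"
  define A where "A = {as :: sl2b list. length as = n}"
  have "Phi (act X \<phi>) \<beta>
      = (\<Sum>as\<in>A. \<Sum>i<n. \<Sum>a\<in>UNIV. mat_scale (coef X a (as ! i) * \<phi> (zip (as[i := a]) \<beta>)) (word_mat as))"
    unfolding Phi_eq_sum A_def n_def[symmetric]
  proof (rule sum.cong)
    fix as assume "as \<in> {as :: sl2b list. length as = n}"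
    then have "act X \<phi> (zip as \<beta>) = (\<Sum>i<n. \<Sum>a\<in>UNIV. coef X a (as ! i) * \<phi> (zip (as[i := a]) \<beta>))"
      unfolding act_def UNIV_sl2b by (intro sum.cong) (auto simp: n_def zip_update[symmetric])
    then show "mat_scale (act X \<phi> (zip as \<beta>)) (word_mat as)
        = (\<Sum>i<n. \<Sum>a\<in>UNIV. mat_scale (coef X a (as ! i) * \<phi> (zip (as[i := a]) \<beta>)) (word_mat as))"
      by (simp add: mat_scale_sum_left)
  qed simp
  also have "\<dots> = (\<Sum>i<n. \<Sum>as\<in>A. \<Sum>a\<in>UNIV.
      mat_scale (coef X a (as ! i) * \<phi> (zip (as[i := a]) \<beta>)) (word_mat as))"
    by (rule sum.swap)
  also have "\<dots> = (\<Sum>i<n. \<Sum>bs\<in>A. \<Sum>b\<in>UNIV.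
      mat_scale (coef X (bs ! i) b * \<phi> (zip bs \<beta>)) (word_mat (bs[i := b])))"
  proof (rule sum.cong)
    fix i assume "i \<in> {..<n}"
    then show "(\<Sum>as\<in>A. \<Sum>a\<in>UNIV. mat_scale (coef X a (as ! i) * \<phi> (zip (as[i := a]) \<beta>)) (word_mat as))
      = (\<Sum>bs\<in>A. \<Sum>b\<in>UNIV. mat_scale (coef X (bs ! i) b * \<phi> (zip bs \<beta>)) (word_mat (bs[i := b])))"
      unfolding sum.cartesian_product
      by (intro sum.reindex_bij_witness[where i="\<lambda>(as, a). (as[i := a], as ! i)"
            and j="\<lambda>(as, a). (as[i := a], as ! i)"]) (auto simp: A_def)
  qed simp
  also have "\<dots> = (\<Sum>bs\<in>A. mat_scale (\<phi> (zip bs \<beta>))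
      (\<Sum>i<n. \<Sum>b\<in>UNIV. mat_scale (coef X (bs ! i) b) (word_mat (bs[i := b]))))"
    by (subst sum.swap) (simp add: mat_scale_mat_scale[symmetric] mat_scale_sum_right mult.commute)
  also have "\<dots> = (\<Sum>bs\<in>A. mat_scale (\<phi> (zip bs \<beta>)) (bracket X (word_mat bs)))"
    by (rule sum.cong) (auto simp: A_def bracket_word_mat)
  also have "\<dots> = bracket X (Phi \<phi> \<beta>)"
    by (simp add: Phi_eq_sum bracket_sum bracket_mat_scale A_def n_def)
  finally show ?thesis .
qed

section \<open>The ideal lies in the kernel\<close>

lemma bracket_H_nth:
  "bracket H M $ 0 $ 0 = 0" "bracket H M $ 0 $ 1 = 2 * M $ 0 $ 1"
  "bracket H M $ 1 $ 0 = - 2 * M $ 1 $ 0" "bracket H M $ 1 $ 1 = (0 :: 'k::comm_ring_1)"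
  by (simp_all add: bracket_nth matrix_mult_2_nth)

lemma ad_H_eigenvector_eq_0:
  fixes M :: "'k::idom^2^2"
  assumes "bracket H M = mat_scale c M" and "c \<noteq> 0" "c \<noteq> 2" "c \<noteq> -2"
  shows "M = 0"
proof -
  have entry: "bracket H M $ i $ j = c * M $ i $ j" for i j
    using assms(1) by simp
  have "c * M $ 0 $ 0 = 0" "(c - 2) * M $ 0 $ 1 = 0" "c * M $ 1 $ 1 = 0"
    using entry[of 0 0] entry[of 0 1] entry[of 1 1] by (simp_all add: bracket_H_nth algebra_simps)
  moreover have "(c + 2) * M $ 1 $ 0 = 0"
    using entry[of 1 0, symmetric] by (simp add: bracket_H_nth distrib_right)
  moreover have "c - 2 \<noteq> 0" "c + 2 \<noteq> 0"
    using assms(3,4) by (simp_all add: add_eq_0_iff2)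
  ultimately show ?thesis
    using assms(2) by (simp add: mat2_eq_iff)
qed

lemma Phi_hwv_eq_0:
  assumes "hwv m \<phi>" "m \<noteq> 0" "m \<noteq> 2"
  shows "Phi (\<phi> :: _ \<Rightarrow> 'k::field_char_0) = (\<lambda>_. 0)"
proof
  fix \<beta>
  have "bracket H (Phi \<phi> \<beta>) = mat_scale (of_nat m) (Phi \<phi> \<beta>)"
    using assms(1) by (simp add: hwv_def Phi_act[symmetric] Phi_scale)
  moreover have "(of_nat m :: 'k) \<noteq> -2"
  proof
    assume "(of_nat m :: 'k) = -2"
    then have "(of_nat (m + 2) :: 'k) = 0" by simp
    then show False by (simp only: of_nat_eq_0_iff)
  qed
  moreover have "(of_nat m :: 'k) \<noteq> 2"
    using assms(3) by (metis of_nat_eq_iff of_nat_numeral)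
  ultimately show "Phi \<phi> \<beta> = 0"
    using assms(2) by (intro ad_H_eigenvector_eq_0[where c="of_nat m"]) simp_all
qed

lemma Phi_bad_components_eq_0: "g \<in> bad_components \<Longrightarrow> Phi (g :: _ \<Rightarrow> 'k::field_char_0) = (\<lambda>_. 0)"
proof -
  assume "g \<in> bad_components"
  then obtain i \<phi> m where g: "g = (act F ^^ i) \<phi>" and hwv: "hwv m \<phi>" "m \<noteq> 0" "m \<noteq> 2"
    unfolding bad_components_def by blast
  have "Phi ((act F ^^ j) \<phi>) \<beta> = (0 :: 'k^2^2)" for j \<beta>
  proof (induction j arbitrary: \<beta>)
    case 0
    then show ?case using Phi_hwv_eq_0[OF hwv] by simp
  next
    case (Suc j)
    then show ?case by (simp add: Phi_act bracket_def)
  qed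
  then show ?thesis using g by auto
qed

abbreviation rel_ideal :: "((sl2b \<times> 'b) list \<Rightarrow> 'k::comm_ring_1) set" where
  "rel_ideal \<equiv> ideal_gen bad_components"

lemma Phi_rel_ideal_eq_0:
  "x \<in> rel_ideal \<Longrightarrow> Phi (x :: _ \<Rightarrow> 'k::field_char_0) = (\<lambda>_. 0)"
proof (induction rule: ideal_gen.induct)
  case (gen a b g)
  then show ?case by (simp add: Phi_tmul Phi_bad_components_eq_0 mmul_zero_left mmul_zero_right)
qed (simp_all add: Phi_zero Phi_add fun_eq_iff)

section \<open>Normal words\<close>

definition normal_pairs :: "sl2b list set" where
  "normal_pairs = {[E, F], [F, E], [H, E], [H, F]}"

definition normal_word :: "sl2b list \<Rightarrow> bool" where
  "normal_word as \<longleftrightarrow> length as \<le> 1 \<or> (\<exists>p\<in>normal_pairs. \<exists>k. as = p @ replicate k H)"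

lemma sum_normal_pairs: "(\<Sum>p\<in>normal_pairs. f p) = f [E, F] + f [F, E] + f [H, E] + f [H, F]"
  by (simp add: normal_pairs_def add.assoc)

lemma word_mat_replicate_H_nth [simp]:
  "word_mat (replicate k H) $ 0 $ 0 = 1" "word_mat (replicate k H) $ 0 $ 1 = 0"
  "word_mat (replicate k H) $ 1 $ 0 = 0" "word_mat (replicate k H) $ 1 $ 1 = (-1) ^ k"
  by (induction k) (simp_all add: matrix_mult_2_nth)

lemma Phi_Nil: "Phi \<phi> [] = mat (\<phi> [])"
proof -
  have "{as :: sl2b list. length as = 0} = {[]}" by auto
  then show ?thesis by (simp add: Phi_eq_sum vec_eq_iff mat_def)
qed

lemma Phi_singleton: "Phi \<phi> [b] = (\<Sum>a\<in>UNIV. mat_scale (\<phi> [(a, b)]) (mat_of a))"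
proof -
  have "{as :: sl2b list. length as = 1} = (\<lambda>a. [a]) ` UNIV"
    by (auto simp: length_Suc_conv)
  then show ?thesis by (simp add: Phi_eq_sum sum.reindex inj_on_def)
qed

lemma Phi_singleton_nth:
  "Phi \<phi> [b] $ 0 $ 0 = \<phi> [(H, b)]" "Phi \<phi> [b] $ 1 $ 1 = - \<phi> [(H, b)]"
  "Phi \<phi> [b] $ 0 $ 1 = \<phi> [(E, b)]" "Phi \<phi> [b] $ 1 $ 0 = \<phi> [(F, b)]"
  by (simp_all add: Phi_singleton sum_sl2b)

lemma Phi_normal:
  assumes "\<And>w. \<phi> w \<noteq> 0 \<Longrightarrow> normal_word (map fst w)" and "length \<beta> = k + 2"
  shows "Phi \<phi> \<beta> = (\<Sum>p\<in>normal_pairs.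
    mat_scale (\<phi> (zip (p @ replicate k H) \<beta>)) (word_mat p ** word_mat (replicate k H)))"
proof -
  let ?N = "(\<lambda>p. p @ replicate k H) ` normal_pairs"
  have "?N \<subseteq> {as. length as = length \<beta>}"
    using assms(2) by (auto simp: normal_pairs_def)
  moreover have "\<phi> (zip as \<beta>) = 0" if len: "length as = length \<beta>" and "as \<notin> ?N" for as
  proof (rule ccontr)
    assume "\<phi> (zip as \<beta>) \<noteq> 0"
    then have "normal_word as"
      using assms(1)[of "zip as \<beta>"] len by simp
    then obtain p k' where "p \<in> normal_pairs" "as = p @ replicate k' H"
      using len assms(2) unfolding normal_word_def by auto
    moreover from this have "k' = k"
      using len assms(2) by (auto simp: normal_pairs_def)
    ultimately show False using \<open>as \<notin> ?N\<close> by auto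
  qed
  ultimately have "Phi \<phi> \<beta> = (\<Sum>as\<in>?N. mat_scale (\<phi> (zip as \<beta>)) (word_mat as))"
    unfolding Phi_eq_sum by (intro sum.mono_neutral_right) auto
  then show ?thesis
    by (simp add: sum.reindex inj_on_def word_mat_append)
qed

lemma Phi_normal_nth:
  assumes "\<And>w. \<phi> w \<noteq> 0 \<Longrightarrow> normal_word (map fst w)" and "length \<beta> = k + 2"
  shows "Phi \<phi> \<beta> $ 0 $ 0 = \<phi> (zip ([E, F] @ replicate k H) \<beta>)"
    and "Phi \<phi> \<beta> $ 1 $ 1 = (-1) ^ k * \<phi> (zip ([F, E] @ replicate k H) \<beta>)"
    and "Phi \<phi> \<beta> $ 0 $ 1 = (-1) ^ k * \<phi> (zip ([H, E] @ replicate k H) \<beta>)"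
    and "Phi \<phi> \<beta> $ 1 $ 0 = - \<phi> (zip ([H, F] @ replicate k H) \<beta>)"
  using assms by (simp_all add: Phi_normal sum_normal_pairs matrix_mult_2_nth mult.commute)

lemma Phi_normal_eq_0:
  assumes normal: "\<And>w. \<phi> w \<noteq> 0 \<Longrightarrow> normal_word (map fst w)"
    and zero: "\<And>\<beta>. Phi \<phi> \<beta> = (0 :: 'k::idom^2^2)"
  shows "\<phi> w = 0"
proof (rule ccontr)
  assume nz: "\<phi> w \<noteq> 0"
  define as where "as = map fst w"
  define \<beta> where "\<beta> = map snd w"
  have w: "w = zip as \<beta>" "length as = length \<beta>"
    unfolding as_def \<beta>_def by (simp_all add: zip_map_fst_snd)
  have "normal_word as" using normal[OF nz] by (simp add: as_def)
  then consider "as = []" | a where "as = [a]" | p k where "p \<in> normal_pairs" "as = p @ replicate k H"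
    unfolding normal_word_def by (auto simp: le_Suc_eq length_Suc_conv)
  then show False
  proof cases
    case 1
    then show False using zero[of "[]"] nz w by (simp add: Phi_Nil mat2_eq_iff)
  next
    case (2 a)
    then obtain b where "\<beta> = [b]" "w = [(a, b)]" using w by (cases \<beta>) auto
    then show False using zero[of "[b]"] nz by (cases a) (simp_all add: Phi_singleton_nth mat2_eq_iff)
  next
    case (3 p k)
    then have "length \<beta> = k + 2" using w by (auto simp: normal_pairs_def)
    from Phi_normal_nth[of \<phi> \<beta> k, OF normal this] zero[of \<beta>] have
      "\<phi> (zip ([E, F] @ replicate k H) \<beta>) = 0" "\<phi> (zip ([F, E] @ replicate k H) \<beta>) = 0"
      "\<phi> (zip ([H, E] @ replicate k H) \<beta>) = 0" "\<phi> (zip ([H, F] @ replicate k H) \<beta>) = 0"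
      by simp_all
    then show False using 3 nz w by (auto simp: normal_pairs_def)
  qed
qed

definition normal_preimage :: "('b list \<Rightarrow> 'k::comm_ring_1^2^2) \<Rightarrow> (sl2b \<times> 'b) list \<Rightarrow> 'k" where
  "normal_preimage M w = (let as = map fst w; \<beta> = map snd w; k = length as - 2 in
     if as = [] then M \<beta> $ 0 $ 0
     else if as = [E] then M \<beta> $ 0 $ 1
     else if as = [H] then M \<beta> $ 0 $ 0
     else if as = [F] then M \<beta> $ 1 $ 0
     else if as = [E, F] @ replicate k H then M \<beta> $ 0 $ 0
     else if as = [F, E] @ replicate k H then (-1) ^ k * M \<beta> $ 1 $ 1
     else if as = [H, E] @ replicate k H then (-1) ^ k * M \<beta> $ 0 $ 1
     else if as = [H, F] @ replicate k H then - M \<beta> $ 1 $ 0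
     else 0)"

lemma normal_preimage_normal: "normal_preimage M w \<noteq> 0 \<Longrightarrow> normal_word (map fst w)"
  unfolding normal_preimage_def normal_word_def normal_pairs_def Let_def
  by (auto split: if_splits)

lemma finsupp_normal_preimage:
  assumes "finite {\<beta>. M \<beta> \<noteq> 0}"
  shows "finsupp (normal_preimage M)"
proof -
  have "{w. normal_preimage M w \<noteq> 0}
      \<subseteq> (\<Union>\<beta>\<in>{\<beta>. M \<beta> \<noteq> 0}. (\<lambda>as. zip as \<beta>) ` {as. length as = length \<beta>})"
  proof
    fix w assume "w \<in> {w. normal_preimage M w \<noteq> 0}"
    then have "M (map snd w) \<noteq> 0"
      unfolding normal_preimage_def Let_def by (auto split: if_splits)
    then show "w \<in> (\<Union>\<beta>\<in>{\<beta>. M \<beta> \<noteq> 0}. (\<lambda>as. zip as \<beta>) ` {as. length as = length \<beta>})"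
      by (intro UN_I[of "map snd w"] image_eqI[of _ _ "map fst w"]) (simp_all add: zip_map_fst_snd)
  qed
  moreover have "finite (\<Union>\<beta>\<in>{\<beta>. M \<beta> \<noteq> 0}. (\<lambda>as. zip as \<beta>) ` {as :: sl2b list. length as = length \<beta>})"
    using assms by auto
  ultimately show ?thesis unfolding finsupp_def by (rule finite_subset)
qed

lemma Phi_normal_preimage:
  assumes "M \<in> TKK_alg"
  shows "Phi (normal_preimage M) \<beta> = M \<beta>"
proof -
  obtain c where c: "M [] = mat c" using assms by (auto simp: TKK_alg_def)
  consider "\<beta> = []" | b where "\<beta> = [b]" | k where "length \<beta> = k + 2"
    by (metis add_2_eq_Suc' length_0_conv length_Suc_conv not0_implies_Suc)
  then show ?thesis
  proof cases
    case 1
    then show ?thesis using c by (simp add: Phi_Nil normal_preimage_def mat2_eq_iff)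
  next
    case (2 b)
    then have "M \<beta> $ 1 $ 1 = - M \<beta> $ 0 $ 0"
      using assms by (simp add: TKK_alg_def eq_neg_iff_add_eq_0 add.commute)
    then show ?thesis using 2 by (simp add: Phi_singleton_nth mat2_eq_iff normal_preimage_def)
  next
    case 3
    have "map fst (zip (p @ replicate k H) \<beta>) = p @ replicate k H"
      and "map snd (zip (p @ replicate k H) \<beta>) = \<beta>" if "length p = 2" for p
      using 3 that by simp_all
    then show ?thesis
      using Phi_normal_nth[of "normal_preimage M" \<beta> k, OF normal_preimage_normal[of M] 3] 3
      by (simp add: mat2_eq_iff normal_preimage_def mult.assoc[symmetric])
  qed
qed

lemma Phi_in_TKK_alg:
  assumes "finsupp \<phi>"
  shows "Phi \<phi> \<in> TKK_alg"
proof -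
  have "{\<beta>. Phi \<phi> \<beta> \<noteq> 0} \<subseteq> map snd ` {w. \<phi> w \<noteq> 0}"
  proof
    fix \<beta> assume "\<beta> \<in> {\<beta>. Phi \<phi> \<beta> \<noteq> 0}"
    then have "(\<Sum>as | length as = length \<beta>. mat_scale (\<phi> (zip as \<beta>)) (word_mat as)) \<noteq> 0"
      by (simp add: Phi_eq_sum)
    then obtain as where "length as = length \<beta>" "mat_scale (\<phi> (zip as \<beta>)) (word_mat as) \<noteq> 0"
      using sum.not_neutral_contains_not_neutral by blast
    then have "\<phi> (zip as \<beta>) \<noteq> 0" "\<beta> = map snd (zip as \<beta>)" by auto
    then show "\<beta> \<in> map snd ` {w. \<phi> w \<noteq> 0}" by blast
  qed
  then have "finite {\<beta>. Phi \<phi> \<beta> \<noteq> 0}"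
    using assms unfolding finsupp_def by (rule finite_subset[OF _ finite_imageI])
  moreover have "Phi \<phi> \<beta> $ 0 $ 0 + Phi \<phi> \<beta> $ 1 $ 1 = 0" if "length \<beta> = 1" for \<beta>
    using that by (auto simp: length_Suc_conv Phi_singleton_nth)
  ultimately show ?thesis unfolding TKK_alg_def by (auto simp: Phi_Nil)
qed

lemma image_Phi: "Phi ` {\<phi> :: _ \<Rightarrow> 'k::comm_ring_1. finsupp \<phi>} = TKK_alg"
proof
  show "TKK_alg \<subseteq> Phi ` {\<phi> :: _ \<Rightarrow> 'k. finsupp \<phi>}"
  proof
    fix M :: "_ \<Rightarrow> 'k^2^2" assume M: "M \<in> TKK_alg"
    then have "finsupp (normal_preimage M)" "Phi (normal_preimage M) = M"
      using Phi_normal_preimage[OF M] by (auto intro: finsupp_normal_preimage simp: TKK_alg_def)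
    then show "M \<in> Phi ` {\<phi>. finsupp \<phi>}" by (metis image_eqI mem_Collect_eq)
  qed
qed (auto intro: Phi_in_TKK_alg)

section \<open>Relations in degrees two and three\<close>

definition tensor2 :: "'b \<Rightarrow> 'b \<Rightarrow> (sl2b \<Rightarrow> sl2b \<Rightarrow> 'k) \<Rightarrow> (sl2b \<times> 'b) list \<Rightarrow> 'k::comm_ring_1" where
  "tensor2 b1 b2 g w = (if map snd w = [b1, b2] then g (fst (w ! 0)) (fst (w ! 1)) else 0)"

definition tensor3 ::
  "'b \<Rightarrow> 'b \<Rightarrow> 'b \<Rightarrow> (sl2b \<Rightarrow> sl2b \<Rightarrow> sl2b \<Rightarrow> 'k) \<Rightarrow> (sl2b \<times> 'b) list \<Rightarrow> 'k::comm_ring_1" where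
  "tensor3 b1 b2 b3 G w
    = (if map snd w = [b1, b2, b3] then G (fst (w ! 0)) (fst (w ! 1)) (fst (w ! 2)) else 0)"

definition delta2 :: "sl2b \<Rightarrow> sl2b \<Rightarrow> sl2b \<Rightarrow> sl2b \<Rightarrow> 'k::comm_ring_1" where
  "delta2 a b x y = (if x = a \<and> y = b then 1 else 0)"

definition delta3 :: "sl2b \<Rightarrow> sl2b \<Rightarrow> sl2b \<Rightarrow> sl2b \<Rightarrow> sl2b \<Rightarrow> sl2b \<Rightarrow> 'k::comm_ring_1" where
  "delta3 a b c x y z = (if x = a \<and> y = b \<and> z = c then 1 else 0)"

lemma map_snd_eq_2: "map snd w = [b1, b2] \<Longrightarrow> \<exists>x y. w = [(x, b1), (y, b2)]"
  by (cases w; cases "tl w"; auto)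

lemma map_snd_eq_3: "map snd w = [b1, b2, b3] \<Longrightarrow> \<exists>x y z. w = [(x, b1), (y, b2), (z, b3)]"
  by (cases w; cases "tl w"; cases "tl (tl w)"; auto)

lemma word_monom_eq_tensor2: "word_monom [(x, b1), (y, b2)] = tensor2 b1 b2 (delta2 x y)"
proof
  fix w
  show "word_monom [(x, b1), (y, b2)] w = tensor2 b1 b2 (delta2 x y) w"
    by (cases "map snd w = [b1, b2]")
      (auto simp: word_monom_def tensor2_def delta2_def dest!: map_snd_eq_2)
qed

lemma word_monom_eq_tensor3: "word_monom [(x, b1), (y, b2), (z, b3)] = tensor3 b1 b2 b3 (delta3 x y z)"
proof
  fix w
  show "word_monom [(x, b1), (y, b2), (z, b3)] w = tensor3 b1 b2 b3 (delta3 x y z) w"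
    by (cases "map snd w = [b1, b2, b3]")
      (auto simp: word_monom_def tensor3_def delta3_def dest!: map_snd_eq_3)
qed

lemma finite_map_snd_eq: "finite {w :: (sl2b \<times> 'b) list. map snd w = \<beta>}"
proof -
  have "{w. map snd w = \<beta>} \<subseteq> (\<lambda>as. zip as \<beta>) ` {as. length as = length \<beta>}"
  proof
    fix w assume "w \<in> {w. map snd w = \<beta>}"
    then have "w = zip (map fst w) \<beta>" "length (map fst w) = length \<beta>"
      using zip_map_fst_snd[of w] by auto
    then show "w \<in> (\<lambda>as. zip as \<beta>) ` {as. length as = length \<beta>}" by blast
  qed
  then show ?thesis by (rule finite_subset) simp
qed

lemma finsupp_tensor2: "finsupp (tensor2 b1 b2 g)"
  unfolding finsupp_def
  by (rule finite_subset[OF _ finite_map_snd_eq[of "[b1, b2]"]]) (auto simp: tensor2_def)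

lemma finsupp_tensor3: "finsupp (tensor3 b1 b2 b3 G)"
  unfolding finsupp_def
  by (rule finite_subset[OF _ finite_map_snd_eq[of "[b1, b2, b3]"]]) (auto simp: tensor3_def)

lemma tensor2_zero: "tensor2 b1 b2 (\<lambda>_ _. 0) = (\<lambda>_. 0)"
  by (simp add: fun_eq_iff tensor2_def)

lemma tensor3_zero: "tensor3 b1 b2 b3 (\<lambda>_ _ _. 0) = (\<lambda>_. 0)"
  by (simp add: fun_eq_iff tensor3_def)

lemma tensor2_scale: "tensor2 b1 b2 (\<lambda>x y. c * g x y) = (\<lambda>w. c * tensor2 b1 b2 g w)"
  by (simp add: fun_eq_iff tensor2_def)

lemma tensor2_diff:
  "tensor2 b1 b2 (\<lambda>x y. g x y - h x y) = (\<lambda>w. tensor2 b1 b2 g w - tensor2 b1 b2 h w)"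
  by (simp add: fun_eq_iff tensor2_def)

lemma tensor3_add:
  "tensor3 b1 b2 b3 (\<lambda>x y z. G x y z + K x y z) = (\<lambda>w. tensor3 b1 b2 b3 G w + tensor3 b1 b2 b3 K w)"
  by (simp add: fun_eq_iff tensor3_def)

lemma tensor3_diff:
  "tensor3 b1 b2 b3 (\<lambda>x y z. G x y z - K x y z) = (\<lambda>w. tensor3 b1 b2 b3 G w - tensor3 b1 b2 b3 K w)"
  by (simp add: fun_eq_iff tensor3_def)

definition ad2 :: "sl2b \<Rightarrow> (sl2b \<Rightarrow> sl2b \<Rightarrow> 'k::comm_ring_1) \<Rightarrow> sl2b \<Rightarrow> sl2b \<Rightarrow> 'k" where
  "ad2 X g x y = (\<Sum>a\<in>UNIV. coef X a x * g a y) + (\<Sum>a\<in>UNIV. coef X a y * g x a)"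

lemma act_tensor2:
  fixes g :: "sl2b \<Rightarrow> sl2b \<Rightarrow> 'k::comm_ring_1"
  shows "act X (tensor2 b1 b2 g) = tensor2 b1 b2 (ad2 X g)"
proof
  fix w
  show "act X (tensor2 b1 b2 g) w = tensor2 b1 b2 (ad2 X g) w"
  proof (cases "map snd w = [b1, b2]")
    case True
    then obtain x y where "w = [(x, b1), (y, b2)]" using map_snd_eq_2[OF True] by blast
    moreover have "(\<Sum>i<2. f i) = f 0 + f (1 :: nat)" for f :: "nat \<Rightarrow> 'k"
      by (simp add: numeral_2_eq_2)
    ultimately show ?thesis by (simp add: act_def tensor2_def ad2_def sum_sl2b)
  next
    case False
    moreover have "map snd (w[i := (a, snd (w ! i))]) = map snd w" for i a
      by (metis list_update_id map_update snd_conv)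
    ultimately show ?thesis by (simp add: act_def tensor2_def)
  qed
qed

lemma ad2_scale: "ad2 X (\<lambda>x y. c * g x y) = (\<lambda>x y. c * ad2 X g x y)"
  by (simp add: fun_eq_iff ad2_def sum_distrib_left distrib_left mult.left_commute)

lemma ad2_uminus: "ad2 X (\<lambda>x y. - g x y) = (\<lambda>x y. - ad2 X g x y)"
  by (simp add: fun_eq_iff ad2_def sum_negf[symmetric] add.commute)

definition rel_EE :: "sl2b \<Rightarrow> sl2b \<Rightarrow> 'k::comm_ring_1" where
  "rel_EE x y = delta2 E E x y"

definition rel_EH :: "sl2b \<Rightarrow> sl2b \<Rightarrow> 'k::comm_ring_1" where
  "rel_EH x y = delta2 E H x y + delta2 H E x y"

definition rel_HH :: "sl2b \<Rightarrow> sl2b \<Rightarrow> 'k::comm_ring_1" where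
  "rel_HH x y = delta2 H H x y - delta2 E F x y - delta2 F E x y"

definition rel_FH :: "sl2b \<Rightarrow> sl2b \<Rightarrow> 'k::comm_ring_1" where
  "rel_FH x y = delta2 F H x y + delta2 H F x y"

definition rel_FF :: "sl2b \<Rightarrow> sl2b \<Rightarrow> 'k::comm_ring_1" where
  "rel_FF x y = delta2 F F x y"

lemmas rel_defs = rel_EE_def rel_EH_def rel_HH_def rel_FH_def rel_FF_def delta2_def

lemma ad2_E_rel_EE: "ad2 E rel_EE = (\<lambda>_ _. 0)"
  and ad2_H_rel_EE: "ad2 H rel_EE = (\<lambda>x y. 4 * rel_EE x y)"
  by (simp_all add: fun_eq_iff all_sl2b ad2_def sum_sl2b rel_defs)

lemma ad2_F_rels:
  "ad2 F rel_EE = (\<lambda>x y. - rel_EH x y)" "ad2 F rel_EH = (\<lambda>x y. - 2 * rel_HH x y)"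
  "ad2 F rel_HH = (\<lambda>x y. 3 * rel_FH x y)" "ad2 F rel_FH = (\<lambda>x y. 4 * rel_FF x y)"
  by (simp_all add: fun_eq_iff all_sl2b ad2_def sum_sl2b rel_defs)

definition quadratic_rels :: "'b \<Rightarrow> 'b \<Rightarrow> (sl2b \<Rightarrow> sl2b \<Rightarrow> 'k::comm_ring_1) set" where
  "quadratic_rels b1 b2 = {g. tensor2 b1 b2 g \<in> rel_ideal}"

definition cubic_rels :: "'b \<Rightarrow> 'b \<Rightarrow> 'b \<Rightarrow> (sl2b \<Rightarrow> sl2b \<Rightarrow> sl2b \<Rightarrow> 'k::comm_ring_1) set" where
  "cubic_rels b1 b2 b3 = {G. tensor3 b1 b2 b3 G \<in> rel_ideal}"

lemma quadratic_rels_scale: "g \<in> quadratic_rels b1 b2 \<Longrightarrow> (\<lambda>x y. c * g x y) \<in> quadratic_rels b1 b2"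
  by (simp add: quadratic_rels_def tensor2_scale ideal_gen_scale)

lemma quadratic_rels_zero: "(\<lambda>_ _. 0) \<in> quadratic_rels b1 b2"
  by (simp add: quadratic_rels_def tensor2_zero ideal_gen.zero)

lemma cubic_rels_zero: "(\<lambda>_ _ _. 0) \<in> cubic_rels b1 b2 b3"
  by (simp add: cubic_rels_def tensor3_zero ideal_gen.zero)

lemma cubic_rels_add:
  "G \<in> cubic_rels b1 b2 b3 \<Longrightarrow> K \<in> cubic_rels b1 b2 b3 \<Longrightarrow> (\<lambda>x y z. G x y z + K x y z) \<in> cubic_rels b1 b2 b3"
  by (simp add: cubic_rels_def tensor3_add ideal_gen.add)

lemma cubic_rels_diff:
  "G \<in> cubic_rels b1 b2 b3 \<Longrightarrow> K \<in> cubic_rels b1 b2 b3 \<Longrightarrow> (\<lambda>x y z. G x y z - K x y z) \<in> cubic_rels b1 b2 b3"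
  by (simp add: cubic_rels_def tensor3_diff ideal_gen_diff)

lemma quadratic_relations:
  fixes b1 b2 :: 'b
  shows "rel_EE \<in> (quadratic_rels b1 b2 :: (_ \<Rightarrow> _ \<Rightarrow> 'k::field_char_0) set)"
    and "rel_EH \<in> (quadratic_rels b1 b2 :: (_ \<Rightarrow> _ \<Rightarrow> 'k) set)"
    and "rel_HH \<in> (quadratic_rels b1 b2 :: (_ \<Rightarrow> _ \<Rightarrow> 'k) set)"
    and "rel_FH \<in> (quadratic_rels b1 b2 :: (_ \<Rightarrow> _ \<Rightarrow> 'k) set)"
    and "rel_FF \<in> (quadratic_rels b1 b2 :: (_ \<Rightarrow> _ \<Rightarrow> 'k) set)"
proof -
  have "hwv 4 (tensor2 b1 b2 (rel_EE :: _ \<Rightarrow> _ \<Rightarrow> 'k))"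
    unfolding hwv_def act_tensor2 ad2_E_rel_EE ad2_H_rel_EE tensor2_scale tensor2_zero
    by (simp add: finsupp_tensor2)
  moreover have "(4 :: nat) \<noteq> 0" "(4 :: nat) \<noteq> 2" by simp_all
  ultimately have "(act F ^^ i) (tensor2 b1 b2 (rel_EE :: _ \<Rightarrow> _ \<Rightarrow> 'k)) \<in> bad_components" for i
    unfolding bad_components_def by blast
  moreover have "(act F ^^ i) (tensor2 b1 b2 g) = tensor2 b1 b2 ((ad2 F ^^ i) g)"
    for i and g :: "_ \<Rightarrow> _ \<Rightarrow> 'k"
    by (induction i) (simp_all add: act_tensor2)
  ultimately have F_power: "(ad2 F ^^ i) (rel_EE :: _ \<Rightarrow> _ \<Rightarrow> 'k) \<in> quadratic_rels b1 b2" for i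
    by (simp add: quadratic_rels_def ideal_gen_generator)
  have "(ad2 F ^^ 2) rel_EE = (\<lambda>x y. 2 * (rel_HH x y :: 'k))"
    "(ad2 F ^^ 3) rel_EE = (\<lambda>x y. 6 * (rel_FH x y :: 'k))"
    "(ad2 F ^^ 4) rel_EE = (\<lambda>x y. 24 * (rel_FF x y :: 'k))"
    by (simp_all add: eval_nat_numeral ad2_F_rels ad2_scale ad2_uminus)
  note F_power_eq = this
  show "rel_EE \<in> (quadratic_rels b1 b2 :: (_ \<Rightarrow> _ \<Rightarrow> 'k) set)"
    using F_power[of 0] by simp
  show "rel_EH \<in> (quadratic_rels b1 b2 :: (_ \<Rightarrow> _ \<Rightarrow> 'k) set)"
    using quadratic_rels_scale[OF F_power[of 1], of "- 1"] by (simp add: ad2_F_rels)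
  show "rel_HH \<in> (quadratic_rels b1 b2 :: (_ \<Rightarrow> _ \<Rightarrow> 'k) set)"
    using quadratic_rels_scale[OF F_power[of 2], of "inverse 2"] by (simp add: F_power_eq)
  show "rel_FH \<in> (quadratic_rels b1 b2 :: (_ \<Rightarrow> _ \<Rightarrow> 'k) set)"
    using quadratic_rels_scale[OF F_power[of 3], of "inverse 6"] by (simp add: F_power_eq)
  show "rel_FF \<in> (quadratic_rels b1 b2 :: (_ \<Rightarrow> _ \<Rightarrow> 'k) set)"
    using quadratic_rels_scale[OF F_power[of 4], of "inverse 24"] by (simp add: F_power_eq)
qed

definition rmul_letter :: "(sl2b \<Rightarrow> sl2b \<Rightarrow> 'k) \<Rightarrow> sl2b \<Rightarrow> sl2b \<Rightarrow> sl2b \<Rightarrow> sl2b \<Rightarrow> 'k::comm_ring_1" where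
  "rmul_letter r c x y z = r x y * (if z = c then 1 else 0)"

definition lmul_letter :: "sl2b \<Rightarrow> (sl2b \<Rightarrow> sl2b \<Rightarrow> 'k) \<Rightarrow> sl2b \<Rightarrow> sl2b \<Rightarrow> sl2b \<Rightarrow> 'k::comm_ring_1" where
  "lmul_letter c r x y z = (if x = c then 1 else 0) * r y z"

lemma tmul_tensor2_word_monom:
  "tmul (tensor2 b1 b2 r) (word_monom [(c, b3)]) = tensor3 b1 b2 b3 (rmul_letter r c)"
proof
  fix w
  show "tmul (tensor2 b1 b2 r) (word_monom [(c, b3)]) w = tensor3 b1 b2 b3 (rmul_letter r c) w"
  proof (cases "map snd w = [b1, b2, b3]")
    case True
    then obtain x y z where "w = [(x, b1), (y, b2), (z, b3)]" using map_snd_eq_3[OF True] by blast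
    then show ?thesis by (simp add: tmul_word_monom_right tensor2_def tensor3_def rmul_letter_def)
  next
    case False
    have "tensor2 b1 b2 r (take (length w - 1) w) = 0" if "drop (length w - 1) w = [(c, b3)]"
    proof (rule ccontr)
      assume "tensor2 b1 b2 r (take (length w - 1) w) \<noteq> 0"
      then have "map snd (take (length w - 1) w @ drop (length w - 1) w) = [b1, b2, b3]"
        using that by (simp add: tensor2_def split: if_splits)
      then show False using False by simp
    qed
    then show ?thesis using False by (simp add: tmul_word_monom_right tensor3_def)
  qed
qed

lemma tmul_word_monom_tensor2:
  "tmul (word_monom [(c, b1)]) (tensor2 b2 b3 r) = tensor3 b1 b2 b3 (lmul_letter c r)"
proof
  fix w
  show "tmul (word_monom [(c, b1)]) (tensor2 b2 b3 r) w = tensor3 b1 b2 b3 (lmul_letter c r) w"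
  proof (cases "map snd w = [b1, b2, b3]")
    case True
    then obtain x y z where "w = [(x, b1), (y, b2), (z, b3)]" using map_snd_eq_3[OF True] by blast
    then show ?thesis by (simp add: tmul_word_monom_left tensor2_def tensor3_def lmul_letter_def)
  next
    case False
    have "tensor2 b2 b3 r (drop 1 w) = 0" if "take 1 w = [(c, b1)]"
    proof (rule ccontr)
      assume "tensor2 b2 b3 r (drop 1 w) \<noteq> 0"
      then have "map snd (take 1 w @ drop 1 w) = [b1, b2, b3]"
        using that by (simp add: tensor2_def split: if_splits)
      then show False using False by simp
    qed
    then show ?thesis using False by (simp add: tmul_word_monom_left tensor3_def)
  qed
qed

lemma rmul_letter_mem: "r \<in> quadratic_rels b1 b2 \<Longrightarrow> rmul_letter r c \<in> cubic_rels b1 b2 b3"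
  unfolding quadratic_rels_def cubic_rels_def
  by (simp add: ideal_gen_tmul_right tmul_tensor2_word_monom[symmetric])

lemma lmul_letter_mem: "r \<in> quadratic_rels b2 b3 \<Longrightarrow> lmul_letter c r \<in> cubic_rels b1 b2 b3"
  unfolding quadratic_rels_def cubic_rels_def
  by (simp add: ideal_gen_tmul_left tmul_word_monom_tensor2[symmetric])

text \<open>A word of length two, or of length three ending in a normal pair, is congruent modulo
  the quadratic relations to the unique combination of normal words with the same matrix
  product. The tables \<open>quadratic_nf\<close> and \<open>cubic_nf\<close> list these combinations, and the
  tables \<open>quadratic_witness\<close> and \<open>cubic_witness\<close> express each difference through the
  relations.\<close>

fun quadratic_nf :: "sl2b \<Rightarrow> sl2b \<Rightarrow> sl2b \<Rightarrow> sl2b \<Rightarrow> 'k::comm_ring_1" where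
  "quadratic_nf E E = (\<lambda>_ _. 0)"
| "quadratic_nf E H = (\<lambda>x y. - delta2 H E x y)"
| "quadratic_nf H H = (\<lambda>x y. delta2 E F x y + delta2 F E x y)"
| "quadratic_nf F H = (\<lambda>x y. - delta2 H F x y)"
| "quadratic_nf F F = (\<lambda>_ _. 0)"
| "quadratic_nf x y = delta2 x y"

fun quadratic_witness :: "sl2b \<Rightarrow> sl2b \<Rightarrow> sl2b \<Rightarrow> sl2b \<Rightarrow> 'k::comm_ring_1" where
  "quadratic_witness E E = rel_EE"
| "quadratic_witness E H = rel_EH"
| "quadratic_witness H H = rel_HH"
| "quadratic_witness F H = rel_FH"
| "quadratic_witness F F = rel_FF"
| "quadratic_witness _ _ = (\<lambda>_ _. 0)"

lemma quadratic_nf_normal: "quadratic_nf x y x' y' \<noteq> 0 \<Longrightarrow> [x', y'] \<in> normal_pairs"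
  by (cases x; cases y) (auto simp: delta2_def normal_pairs_def split: if_splits)

lemma quadratic_reduction:
  "(\<lambda>x' y'. delta2 x y x' y' - quadratic_nf x y x' y')
    \<in> (quadratic_rels b1 b2 :: (_ \<Rightarrow> _ \<Rightarrow> 'k::field_char_0) set)"
proof -
  have "(\<lambda>x' y'. delta2 x y x' y' - quadratic_nf x y x' y') = (quadratic_witness x y :: _ \<Rightarrow> _ \<Rightarrow> 'k)"
    by (cases x; cases y) (simp_all add: fun_eq_iff all_sl2b rel_defs)
  moreover have "(quadratic_witness x y :: _ \<Rightarrow> _ \<Rightarrow> 'k) \<in> quadratic_rels b1 b2"
    by (cases x; cases y) (simp_all add: quadratic_relations quadratic_rels_zero)
  ultimately show ?thesis by simp
qed

fun cubic_nf :: "sl2b \<Rightarrow> sl2b \<Rightarrow> sl2b \<Rightarrow> sl2b \<Rightarrow> sl2b \<Rightarrow> sl2b \<Rightarrow> 'k::comm_ring_1" where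
  "cubic_nf E F E = (\<lambda>x y z. - delta3 H E H x y z)"
| "cubic_nf E H F = (\<lambda>x y z. - delta3 E F H x y z)"
| "cubic_nf H E F = delta3 E F H"
| "cubic_nf H F E = delta3 F E H"
| "cubic_nf H H E = (\<lambda>x y z. - delta3 H E H x y z)"
| "cubic_nf H H F = (\<lambda>x y z. - delta3 H F H x y z)"
| "cubic_nf F E F = (\<lambda>x y z. - delta3 H F H x y z)"
| "cubic_nf F H E = (\<lambda>x y z. - delta3 F E H x y z)"
| "cubic_nf _ _ _ = (\<lambda>_ _ _. 0)"

fun cubic_witness :: "sl2b \<Rightarrow> sl2b \<Rightarrow> sl2b \<Rightarrow> sl2b \<Rightarrow> sl2b \<Rightarrow> sl2b \<Rightarrow> 'k::comm_ring_1" where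
  "cubic_witness E E F = rmul_letter rel_EE F"
| "cubic_witness E F E = (\<lambda>x y z. rmul_letter rel_EH H x y z - rmul_letter rel_EE F x y z
      - lmul_letter E rel_HH x y z)"
| "cubic_witness E H E = (\<lambda>x y z. lmul_letter E rel_EH x y z - rmul_letter rel_EE H x y z)"
| "cubic_witness E H F = lmul_letter E rel_FH"
| "cubic_witness H E F = (\<lambda>x y z. rmul_letter rel_EH F x y z - lmul_letter E rel_FH x y z)"
| "cubic_witness H F E = (\<lambda>x y z. rmul_letter rel_HH H x y z - rmul_letter rel_EH F x y z
      + lmul_letter E rel_FH x y z - lmul_letter H rel_HH x y z)"
| "cubic_witness H H E = lmul_letter H rel_EH"
| "cubic_witness H H F = lmul_letter H rel_FH"
| "cubic_witness F E F = (\<lambda>x y z. lmul_letter H rel_FH x y z - rmul_letter rel_HH F x y z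
      - lmul_letter E rel_FF x y z)"
| "cubic_witness F F E = rmul_letter rel_FF E"
| "cubic_witness F H E = (\<lambda>x y z. rmul_letter rel_EH F x y z - rmul_letter rel_HH H x y z
      + rmul_letter rel_FH E x y z - lmul_letter E rel_FH x y z + lmul_letter H rel_HH x y z)"
| "cubic_witness F H F = (\<lambda>x y z. rmul_letter rel_FH F x y z - lmul_letter H rel_FF x y z)"
| "cubic_witness _ _ _ = (\<lambda>_ _ _. 0)"

lemma cubic_nf_normal: "cubic_nf x y z x' y' z' \<noteq> 0 \<Longrightarrow> [x', y'] \<in> normal_pairs \<and> z' = H"
  by (cases x; cases y; cases z) (auto simp: delta3_def normal_pairs_def split: if_splits)

lemma cubic_witness_mem: "(cubic_witness x y z :: _ \<Rightarrow> _ \<Rightarrow> _ \<Rightarrow> 'k::field_char_0) \<in> cubic_rels b1 b2 b3"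
  by (cases x; cases y; cases z; simp only: cubic_witness.simps;
      intro cubic_rels_add cubic_rels_diff cubic_rels_zero rmul_letter_mem lmul_letter_mem
        quadratic_relations)

lemma cubic_reduction:
  assumes "[y, z] \<in> normal_pairs"
  shows "(\<lambda>x' y' z'. delta3 x y z x' y' z' - cubic_nf x y z x' y' z')
    \<in> (cubic_rels b1 b2 b3 :: (_ \<Rightarrow> _ \<Rightarrow> _ \<Rightarrow> 'k::field_char_0) set)"
proof -
  have "(\<lambda>x' y' z'. delta3 x y z x' y' z' - cubic_nf x y z x' y' z')
      = (cubic_witness x y z :: _ \<Rightarrow> _ \<Rightarrow> _ \<Rightarrow> 'k)"
    using assms
    by (cases x; cases y; cases z)
      (simp_all add: normal_pairs_def fun_eq_iff all_sl2b delta3_def rmul_letter_def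
        lmul_letter_def rel_defs)
  then show ?thesis using cubic_witness_mem by metis
qed

section \<open>Reduction to normal words\<close>

definition normal_comb :: "((sl2b \<times> 'b) list \<Rightarrow> 'k::comm_ring_1) \<Rightarrow> bool" where
  "normal_comb N \<longleftrightarrow> finsupp N \<and> (\<forall>w. N w \<noteq> 0 \<longrightarrow> normal_word (map fst w))"

definition reduces_to_normal :: "((sl2b \<times> 'b) list \<Rightarrow> 'k::comm_ring_1) \<Rightarrow> bool" where
  "reduces_to_normal \<phi> \<longleftrightarrow> (\<exists>N. normal_comb N \<and> (\<lambda>w. \<phi> w - N w) \<in> rel_ideal)"

lemma normal_comb_add: "normal_comb M \<Longrightarrow> normal_comb N \<Longrightarrow> normal_comb (\<lambda>w. M w + N w)"
  unfolding normal_comb_def by (metis add.right_neutral add_0 finsupp_add)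

lemma normal_comb_scale: "normal_comb N \<Longrightarrow> normal_comb (\<lambda>w. c * N w)"
  unfolding normal_comb_def by (metis finsupp_scale mult_zero_right)

lemma normal_comb_word_monom: "normal_word (map fst u) \<Longrightarrow> normal_comb (word_monom u)"
  by (simp add: normal_comb_def word_monom_def)

lemma normal_word_normal_pair: "p \<in> normal_pairs \<Longrightarrow> normal_word (p @ replicate k H)"
  unfolding normal_word_def by blast

lemma normal_comb_tensor2:
  assumes "\<And>x y. g x y \<noteq> 0 \<Longrightarrow> [x, y] \<in> normal_pairs"
  shows "normal_comb (tensor2 b1 b2 g)"
  unfolding normal_comb_def
proof (intro conjI allI impI finsupp_tensor2)
  fix w assume "tensor2 b1 b2 g w \<noteq> 0"
  then obtain x y where "w = [(x, b1), (y, b2)]" "g x y \<noteq> 0"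
    by (auto simp: tensor2_def split: if_splits dest!: map_snd_eq_2)
  then show "normal_word (map fst w)"
    using normal_word_normal_pair[OF assms, of x y 0] by simp
qed

lemma normal_comb_tmul_tensor3:
  assumes "\<And>x y z. G x y z \<noteq> 0 \<Longrightarrow> [x, y] \<in> normal_pairs \<and> z = H"
    and "map fst u = replicate k H"
  shows "normal_comb (tmul (tensor3 b1 b2 b3 G) (word_monom u))"
  unfolding normal_comb_def
proof (intro conjI allI impI finsupp_tmul finsupp_tensor3 finsupp_word_monom)
  fix w assume w: "tmul (tensor3 b1 b2 b3 G) (word_monom u) w \<noteq> 0"
  let ?t = "take (length w - length u) w"
  have drop: "drop (length w - length u) w = u" and "tensor3 b1 b2 b3 G ?t \<noteq> 0"
    using w by (simp_all add: tmul_word_monom_right split: if_splits)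
  then obtain x y z where t: "?t = [(x, b1), (y, b2), (z, b3)]" and "G x y z \<noteq> 0"
    by (auto simp: tensor3_def split: if_splits dest!: map_snd_eq_3)
  then have "[x, y] \<in> normal_pairs" "z = H" using assms(1) by auto
  moreover have "w = [(x, b1), (y, b2), (z, b3)] @ u"
    using t drop by (metis append_take_drop_id)
  ultimately show "normal_word (map fst w)"
    using normal_word_normal_pair[of "[x, y]" "Suc k"] assms(2) by simp
qed

lemma reduces_to_normal_if_normal_comb: "normal_comb N \<Longrightarrow> reduces_to_normal N"
  unfolding reduces_to_normal_def by (intro exI[of _ N]) (simp add: ideal_gen.zero)

lemma reduces_to_normal_add:
  assumes "reduces_to_normal \<phi>" "reduces_to_normal \<psi>"
  shows "reduces_to_normal (\<lambda>w. \<phi> w + \<psi> w)"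
proof -
  obtain M N where M: "normal_comb M" "(\<lambda>w. \<phi> w - M w) \<in> rel_ideal"
    and N: "normal_comb N" "(\<lambda>w. \<psi> w - N w) \<in> rel_ideal"
    using assms unfolding reduces_to_normal_def by blast
  have "(\<lambda>w. (\<phi> w + \<psi> w) - (M w + N w)) = (\<lambda>w. (\<phi> w - M w) + (\<psi> w - N w))"
    by (simp add: algebra_simps)
  then have "(\<lambda>w. (\<phi> w + \<psi> w) - (M w + N w)) \<in> rel_ideal"
    using ideal_gen.add[OF M(2) N(2)] by simp
  then show ?thesis
    using normal_comb_add[OF M(1) N(1)] unfolding reduces_to_normal_def by blast
qed

lemma reduces_to_normal_scale:
  assumes "reduces_to_normal \<phi>"
  shows "reduces_to_normal (\<lambda>w. c * \<phi> w)"
proof -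
  obtain N where N: "normal_comb N" "(\<lambda>w. \<phi> w - N w) \<in> rel_ideal"
    using assms unfolding reduces_to_normal_def by blast
  have "(\<lambda>w. c * \<phi> w - c * N w) \<in> rel_ideal"
    using ideal_gen_scale[OF N(2), of c] by (simp add: right_diff_distrib)
  then show ?thesis
    using normal_comb_scale[OF N(1)] unfolding reduces_to_normal_def by blast
qed

lemma reduces_to_normal_cong:
  assumes "(\<lambda>w. \<phi> w - \<psi> w) \<in> rel_ideal" "reduces_to_normal \<psi>"
  shows "reduces_to_normal \<phi>"
proof -
  obtain N where N: "normal_comb N" "(\<lambda>w. \<psi> w - N w) \<in> rel_ideal"
    using assms(2) unfolding reduces_to_normal_def by blast
  have "(\<lambda>w. \<phi> w - N w) \<in> rel_ideal"
    using ideal_gen.add[OF assms(1) N(2)] by simp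
  then show ?thesis using N(1) unfolding reduces_to_normal_def by blast
qed

lemma reduces_to_normal_finsupp:
  fixes \<phi> :: "(sl2b \<times> 'b) list \<Rightarrow> 'k::comm_ring_1"
  assumes "finsupp \<phi>" and "\<And>u. \<phi> u \<noteq> 0 \<Longrightarrow> reduces_to_normal (word_monom u :: _ \<Rightarrow> 'k)"
  shows "reduces_to_normal \<phi>"
  using assms(1)
proof (induction rule: finsupp_induct)
  case zero
  then show ?case by (simp add: reduces_to_normal_if_normal_comb normal_comb_def)
next
  case (add g h)
  then show ?case by (rule reduces_to_normal_add)
next
  case (monom c u)
  show ?case using assms(2)[OF monom] by (simp add: reduces_to_normal_scale)
qed

lemma reduces_to_normal_quadratic:
  "reduces_to_normal (word_monom [(x, b1), (y, b2)] :: _ \<Rightarrow> 'k::field_char_0)"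
proof -
  have "(\<lambda>w. tensor2 b1 b2 (delta2 x y) w - tensor2 b1 b2 (quadratic_nf x y) w)
      \<in> (rel_ideal :: (_ \<Rightarrow> 'k) set)"
    using quadratic_reduction[of x y b1 b2] by (simp add: quadratic_rels_def tensor2_diff)
  moreover have "reduces_to_normal (tensor2 b1 b2 (quadratic_nf x y) :: _ \<Rightarrow> 'k)"
    using normal_comb_tensor2[OF quadratic_nf_normal] by (rule reduces_to_normal_if_normal_comb)
  ultimately show ?thesis
    unfolding word_monom_eq_tensor2 by (rule reduces_to_normal_cong)
qed

lemma reduces_to_normal_cubic:
  assumes "[y, z] \<in> normal_pairs" and u: "map fst u = replicate k H"
  shows "reduces_to_normal (word_monom ((x, b1) # (y, b2) # (z, b3) # u) :: _ \<Rightarrow> 'k::field_char_0)"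
proof -
  define N :: "_ \<Rightarrow> 'k" where "N = tmul (tensor3 b1 b2 b3 (cubic_nf x y z)) (word_monom u)"
  have monom: "word_monom ((x, b1) # (y, b2) # (z, b3) # u)
      = tmul (tensor3 b1 b2 b3 (delta3 x y z)) (word_monom u)"
    by (simp add: word_monom_eq_tensor3[symmetric] tmul_word_monom)
  have "(\<lambda>w. word_monom ((x, b1) # (y, b2) # (z, b3) # u) w - N w)
      = tmul (tensor3 b1 b2 b3 (\<lambda>x' y' z'. delta3 x y z x' y' z' - cubic_nf x y z x' y' z'))
          (word_monom u)"
    unfolding monom N_def by (simp only: tensor3_diff tmul_diff_left)
  also have "\<dots> \<in> rel_ideal"
    using cubic_reduction[OF assms(1), of x b1 b2 b3]
    unfolding cubic_rels_def by (auto intro: ideal_gen_tmul_right)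
  finally have "(\<lambda>w. word_monom ((x, b1) # (y, b2) # (z, b3) # u) w - N w) \<in> rel_ideal" .
  moreover have "reduces_to_normal N"
    unfolding N_def using normal_comb_tmul_tensor3[OF cubic_nf_normal u]
    by (rule reduces_to_normal_if_normal_comb)
  ultimately show ?thesis by (rule reduces_to_normal_cong)
qed

lemma reduces_to_normal_Cons_normal:
  assumes "normal_word (map fst u)"
  shows "reduces_to_normal (word_monom ((x, b) # u) :: _ \<Rightarrow> 'k::field_char_0)"
proof -
  consider "u = []" | y c where "u = [(y, c)]"
    | y c1 z c2 u' k where "u = (y, c1) # (z, c2) # u'" "[y, z] \<in> normal_pairs"
      "map fst u' = replicate k H"
    using assms unfolding normal_word_def
    by (cases u rule: remdups_adj.cases) (auto simp: normal_pairs_def split_paired_all)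
  then show ?thesis
  proof cases
    case 1
    then show ?thesis
      by (simp add: reduces_to_normal_if_normal_comb normal_comb_word_monom normal_word_def)
  next
    case 2
    then show ?thesis by (simp add: reduces_to_normal_quadratic)
  next
    case 3
    then show ?thesis by (simp add: reduces_to_normal_cubic)
  qed
qed

lemma reduces_to_normal_word_monom: "reduces_to_normal (word_monom w :: _ \<Rightarrow> 'k::field_char_0)"
proof (induction w)
  case Nil
  then show ?case by (simp add: reduces_to_normal_if_normal_comb normal_comb_word_monom normal_word_def)
next
  case (Cons a w)
  obtain x b where a: "a = (x, b)" by (cases a)
  obtain N :: "_ \<Rightarrow> 'k" where N: "normal_comb N" "(\<lambda>v. word_monom w v - N v) \<in> rel_ideal"
    using Cons.IH unfolding reduces_to_normal_def by blast
  from N(1) have "finsupp N" and normal: "\<And>u. N u \<noteq> 0 \<Longrightarrow> normal_word (map fst u)"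
    unfolding normal_comb_def by auto
  from \<open>finsupp N\<close> have "reduces_to_normal (tmul (word_monom [a]) N)"
  proof (induction rule: finsupp_induct)
    case zero
    then show ?case by (simp add: tmul_zero_right reduces_to_normal_if_normal_comb normal_comb_def)
  next
    case (add g h)
    then show ?case by (simp add: tmul_add_right reduces_to_normal_add)
  next
    case (monom c u)
    then show ?case
      by (simp add: tmul_scale_right tmul_word_monom a reduces_to_normal_scale
          reduces_to_normal_Cons_normal normal)
  qed
  moreover have "(\<lambda>v. word_monom (a # w) v - tmul (word_monom [a]) N v) \<in> rel_ideal"
    using ideal_gen_tmul_left[OF N(2), of "word_monom [a]"]
    by (simp add: tmul_diff_right tmul_word_monom)
  ultimately show ?case by (rule reduces_to_normal_cong[rotated])
qed

lemma mem_rel_ideal_if_Phi_eq_0: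
  assumes "finsupp (\<phi> :: _ \<Rightarrow> 'k::field_char_0)" and "Phi \<phi> = (\<lambda>_. 0)"
  shows "\<phi> \<in> rel_ideal"
proof -
  obtain N where N: "normal_comb N" "(\<lambda>w. \<phi> w - N w) \<in> rel_ideal"
    using reduces_to_normal_finsupp[OF assms(1) reduces_to_normal_word_monom]
    unfolding reduces_to_normal_def by blast
  have "\<And>w. N w \<noteq> 0 \<Longrightarrow> normal_word (map fst w)"
    using N(1) by (simp add: normal_comb_def)
  moreover have "Phi N \<beta> = 0" for \<beta>
    using Phi_diff[of \<phi> "\<lambda>w. \<phi> w - N w" \<beta>] assms(2)
      Phi_rel_ideal_eq_0[OF N(2)] by (simp add: fun_eq_iff)
  ultimately have "N w = 0" for w
    by (rule Phi_normal_eq_0)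
  then show ?thesis using N(2) by simp
qed

theorem proposition4p2:
  fixes \<Phi> :: "((sl2b \<times> 'b) list \<Rightarrow> 'k::field_char_0) \<Rightarrow> 'b list \<Rightarrow> 'k^2^2"
  defines "\<Phi> \<equiv> Phi"
  shows "(\<forall>\<phi> \<psi>. finsupp \<phi> \<longrightarrow> finsupp \<psi> \<longrightarrow> \<Phi> (tmul \<phi> \<psi>) = mmul (\<Phi> \<phi>) (\<Phi> \<psi>))
    \<and> \<Phi> tone = mone
    \<and> (\<forall>X \<phi>. finsupp \<phi> \<longrightarrow> \<Phi> (act X \<phi>) = (\<lambda>\<beta>. bracket X (\<Phi> \<phi> \<beta>)))
    \<and> \<Phi> ` {\<phi>. finsupp \<phi>} = TKK_alg
    \<and> (\<forall>\<phi>. finsupp \<phi> \<longrightarrow> (\<Phi> \<phi> = (\<lambda>_. 0) \<longleftrightarrow> \<phi> \<in> ideal_gen bad_components))"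
  unfolding \<Phi>_def
proof (intro conjI allI impI)
  show "Phi (act X \<phi>) = (\<lambda>\<beta>. bracket X (Phi \<phi> \<beta>))" for X and \<phi> :: "_ \<Rightarrow> 'k"
    by (rule ext) (rule Phi_act)
  show "Phi \<phi> = (\<lambda>_. 0) \<longleftrightarrow> \<phi> \<in> ideal_gen bad_components" if "finsupp \<phi>" for \<phi> :: "_ \<Rightarrow> 'k"
    using mem_rel_ideal_if_Phi_eq_0[OF that] Phi_rel_ideal_eq_0 by blast
qed (simp_all add: Phi_tmul Phi_tone image_Phi)

end
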